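(* For all integers $n\ge 0$ and $0\le j\le \lfloor n/2\rfloor$, the polynomial $g_{n,j}(x)$ is real-rooted. Moreover, $g_{n,j}(x)$ interlaces $g_{n+1,j}(x)$ for $0\le j\le \lfloor n/2\rfloor$, and $g_{n,j}(x)$ interlaces $g_{n+1,j+1}(x)$ for $0\le j\le \lfloor (n-1)/2\rfloor$.
   Context: For integers $n\ge j\ge 0$, the toric $g$-contribution polynomial is $$g_{n,j}(x)=\sum_{k=0}^{\min(\lfloor n/2\rfloor,\,n-j)} C_{n-k-j}\binom{n-k}{k}(x-1)^k,$$ where $C_r=\frac{1}{r+1}\binom{2r}{r}$ is the $r$-th Catalan number. A polynomial $f(x)$ with real coefficients is called real-rooted if every root of $f$ is real, or $f\equiv 0$. A real-rooted polynomial $g(x)$ with roots $\cdots\le s_2\le s_1$ (listed with multiplicity) is said to interlace a real-rooted polynomial $f(x)$ with roots $\cdots\le r_2\le r_1$ (listed with multiplicity), written $g\preceq f$, if $$\cdots\le s_2\le r_2\le s_1\le r_1,$$ where the alternating chain contains all roots of both polynomials (so $\deg f-\deg g\in\{0,1\}$ when both are nonzero). By convention, $a\preceq bx+c$ for any real constants $a,b,c$, and $f\preceq 0$, $0\preceq f$ for any real-rooted $f$. *)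

theory Defs
  imports Complex_Main "HOL-Computational_Algebra.Computational_Algebra"
begin

definition catalan :: "nat \<Rightarrow> real" where
  "catalan r = 1 / real (r + 1) * real ((2 * r) choose r)"

(* The paper defines this for j \<le> n only, in which case every natural-number
   subtraction below is exact. *)
definition toric_g :: "nat \<Rightarrow> nat \<Rightarrow> real poly" where
  "toric_g n j =
     (\<Sum>k = 0..min (n div 2) (n - j).
        smult (catalan (n - k - j) * real ((n - k) choose k)) ([:-1, 1:] ^ k))"

(* "Every root" ranges over the complex roots. *)
definition real_rooted :: "real poly \<Rightarrow> bool" where
  "real_rooted f \<longleftrightarrow>
     f = 0 \<or> (\<forall>z::complex. poly (map_poly complex_of_real f) z = 0 \<longrightarrow> z \<in> \<real>)"

(* With 0-based indexing, roots_desc f ! i is the paper's r_(i+1). *)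
definition roots_desc :: "real poly \<Rightarrow> real list" where
  "roots_desc f = rev (sorted_list_of_multiset (proots f))"

(* interlacing_lists ss rs is the chain  ... \<le> s_2 \<le> r_2 \<le> s_1 \<le> r_1.  It starts at r_1,
   alternates, and uses up both lists, so it has either as many s's as r's or one fewer. *)
definition interlacing_lists :: "real list \<Rightarrow> real list \<Rightarrow> bool" where
  "interlacing_lists ss rs \<longleftrightarrow>
     (length rs = length ss \<or> length rs = length ss + 1) \<and>
     (\<forall>i < length ss. ss ! i \<le> rs ! i) \<and>
     (\<forall>i. i + 1 < length rs \<longrightarrow> rs ! (i + 1) \<le> ss ! i)"

(* g \<preceq> f.  The disjuncts other than the last one are the conventions
   f \<preceq> 0, 0 \<preceq> f and a \<preceq> b x + c (for arbitrary real a, b, c). *)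
definition interlaces :: "real poly \<Rightarrow> real poly \<Rightarrow> bool" where
  "interlaces g f \<longleftrightarrow>
     real_rooted g \<and> real_rooted f \<and>
     (f = 0 \<or> g = 0 \<or>
      (\<exists>a b c. g = [:a:] \<and> f = [:c, b:]) \<or>
      interlacing_lists (roots_desc g) (roots_desc f))"

end

theory Submission
  imports Defs
begin

text \<open>
Let \<open>2 j \<le> n\<close> throughout, and write \<open>t = x - 1\<close>. In powers of \<open>t\<close> the coefficients of \<open>g(n, j)\<close>
are products of a Catalan number and a binomial coefficient, and two identities can be read off
from them. Pascal's rule gives \<open>g(n + 1, j + 1) = g(n, j) + (x - 1) g(n - 1, j)\<close> (lemma
\<open>toric_g_pascal\<close>). Together with the recurrence of the Catalan numbers it gives (lemma
\<open>toric_g_rec\<close>) a relation of the following form, with a linear polynomial \<open>L\<close>: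

  \<open>(n - j + 2) g(n + 1, j) = L g(n, j) - 2 x (x - 1) g'(n, j) + 2 (n - 2 j) (x - 1) g(n - 1, j)\<close>

All roots turn out to be simple and at most \<open>0\<close>. At a root \<open>\<alpha> < 0\<close> of \<open>g(n, j)\<close>, the interlacing
of \<open>g(n - 1, j)\<close> and \<open>g(n, j)\<close> says that \<open>g(n - 1, j)\<close> has the sign of \<open>g'(n, j)\<close>. The two
identities then show that \<open>g(n + 1, j)\<close> and \<open>g(n + 1, j + 1)\<close> have the opposite sign at \<open>\<alpha>\<close>, and
by the intermediate value theorem this means that \<open>g(n, j)\<close> interlaces both (lemma
\<open>strictly_interlaced_of_signs\<close>). So there is an induction on \<open>n\<close> for each \<open>j\<close>. It starts at
\<open>n = 2 j\<close>, where the last term of the second identity vanishes and where the first identity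
provides the real-rootedness from the case \<open>j - 1\<close>.

The one difficulty is that \<open>0\<close> is a common root of all \<open>g(n, j)\<close> with \<open>j > 0\<close>. The induction
therefore runs on the quotients \<open>toric_core n j\<close> of these polynomials by \<open>x\<close>. Their values at
\<open>0\<close> are positive, by the same identities, and this keeps their roots strictly negative. The
factor \<open>x\<close> is restored at the end.
\<close>

section \<open>Polynomials with simple real roots\<close>

text \<open>
The roots are indexed from the largest down, as in the definition of interlacing. Since the
leading coefficient is positive, the sign of \<open>P\<close> at a point then depends only on the number of
roots above it. The factorization is oriented from the product to \<open>P\<close> because the other
direction, in which \<open>P\<close> occurs on both sides, would rewrite for ever.
\<close>

definition decreasing_roots :: "nat \<Rightarrow> (nat \<Rightarrow> real) \<Rightarrow> real poly \<Rightarrow> bool" where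
  "decreasing_roots d s P \<longleftrightarrow>
     0 < lead_coeff P \<and> smult (lead_coeff P) (\<Prod>i<d. [:- s i, 1:]) = P \<and>
     (\<forall>i k. i < k \<longrightarrow> k < d \<longrightarrow> s k < s i)"

lemma decreasing_rootsD:
  assumes "decreasing_roots d s P"
  shows "0 < lead_coeff P"
    and "poly P x = lead_coeff P * (\<Prod>i<d. x - s i)"
    and "i < k \<Longrightarrow> k < d \<Longrightarrow> s k < s i"
proof -
  show "0 < lead_coeff P" "i < k \<Longrightarrow> k < d \<Longrightarrow> s k < s i"
    using assms by (auto simp: decreasing_roots_def)
  have "poly (smult (lead_coeff P) (\<Prod>i<d. [:- s i, 1:])) x = poly P x"
    using assms by (simp add: decreasing_roots_def)
  then show "poly P x = lead_coeff P * (\<Prod>i<d. x - s i)"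
    by (simp add: poly_prod)
qed

lemma poly_eq_0_iff_decreasing_roots:
  assumes "decreasing_roots d s P"
  shows "poly P x = 0 \<longleftrightarrow> (\<exists>i<d. x = s i)"
proof -
  have "lead_coeff P \<noteq> 0" using decreasing_rootsD(1)[OF assms] by linarith
  then show ?thesis
    unfolding decreasing_rootsD(2)[OF assms] by (auto simp: prod_zero_iff)
qed

lemma degree_prod_linear: "degree (\<Prod>i<d. [:- s i, 1:] :: real poly) = d"
  by (simp add: degree_prod_eq_sum_degree)

lemma lead_coeff_prod_linear: "lead_coeff (\<Prod>i<d. [:- s i, 1:] :: real poly) = 1"
  by (simp add: lead_coeff_prod)

lemma degree_decreasing_roots:
  assumes "decreasing_roots d s P"
  shows "degree P = d"
proof -
  have "smult (lead_coeff P) (\<Prod>i<d. [:- s i, 1:]) = P" "lead_coeff P \<noteq> 0"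
    using assms by (auto simp: decreasing_roots_def)
  then show ?thesis by (metis degree_prod_linear degree_smult_eq)
qed

lemma decreasing_roots_1: "decreasing_roots 0 s 1"
  by (simp add: decreasing_roots_def)

lemma sign_prod_linear:
  fixes s :: "nat \<Rightarrow> real"
  assumes "m \<le> d" and "\<And>i. i < m \<Longrightarrow> x < s i" and "\<And>i. m \<le> i \<Longrightarrow> i < d \<Longrightarrow> s i < x"
  shows "0 < (-1) ^ m * (\<Prod>i<d. x - s i)"
proof -
  have "{..<d} = {..<m} \<union> {m..<d}" using assms(1) by auto
  then have "(\<Prod>i<d. x - s i) = (\<Prod>i<m. x - s i) * (\<Prod>i=m..<d. x - s i)"
    by (simp add: prod.union_disjoint ivl_disj_int)
  moreover have "(\<Prod>i<m. x - s i) = (-1) ^ m * (\<Prod>i<m. s i - x)"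
  proof -
    have "(\<Prod>i<m. x - s i) = (\<Prod>i<m. (-1) * (s i - x))" by simp
    also have "\<dots> = (-1) ^ m * (\<Prod>i<m. s i - x)" by (subst prod.distrib) simp
    finally show ?thesis .
  qed
  moreover have "0 < (\<Prod>i<m. s i - x)" using assms(2) by (intro prod_pos) auto
  moreover have "0 < (\<Prod>i=m..<d. x - s i)" using assms(3) by (intro prod_pos) auto
  moreover have "(-1::real) ^ m * (-1) ^ m = 1" by (simp flip: power_mult_distrib)
  ultimately show ?thesis
    by (simp add: mult.assoc[symmetric])
qed

lemma sign_poly_decreasing_roots:
  assumes "decreasing_roots d s P"
    and "m \<le> d" and "\<And>i. i < m \<Longrightarrow> x < s i" and "\<And>i. m \<le> i \<Longrightarrow> i < d \<Longrightarrow> s i < x"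
  shows "0 < (-1) ^ m * poly P x"
proof -
  have "0 < lead_coeff P * ((-1) ^ m * (\<Prod>i<d. x - s i))"
    using sign_prod_linear[OF assms(2-4)] decreasing_rootsD(1)[OF assms(1)] by simp
  then show ?thesis
    unfolding decreasing_rootsD(2)[OF assms(1)] by (simp add: mult_ac)
qed

lemma sign_pderiv_decreasing_roots:
  assumes P: "decreasing_roots d s P" and "m < d"
  shows "0 < (-1) ^ m * poly (pderiv P) (s m)"
proof -
  define R where "R = (\<Prod>i\<in>{..<d}-{m}. [:- s i, 1:])"
  define s' where "s' i = (if i < m then s i else s (Suc i))" for i
  have "smult (lead_coeff P) ([:- s m, 1:] * R) = P"
    using P \<open>m < d\<close> unfolding decreasing_roots_def R_def
    by (metis finite_lessThan lessThan_iff prod.remove)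
  then have "pderiv (smult (lead_coeff P) ([:- s m, 1:] * R)) = pderiv P"
    by (rule arg_cong)
  then have "poly (pderiv P) (s m)
      = poly (pderiv (smult (lead_coeff P) ([:- s m, 1:] * R))) (s m)"
    by simp
  also have "\<dots> = lead_coeff P * poly R (s m)"
    by (simp add: pderiv_smult pderiv_mult pderiv_pCons del: mult_pCons_left)
  finally have "poly (pderiv P) (s m) = lead_coeff P * poly R (s m)" .
  moreover have "poly R (s m) = (\<Prod>i\<in>{..<d}-{m}. s m - s i)"
    by (simp add: R_def poly_prod)
  moreover have "\<dots> = (\<Prod>i<d-1. s m - s' i)"
    by (rule prod.reindex_bij_witness[where i = "\<lambda>i. if i < m then i else Suc i"
          and j = "\<lambda>i. if i < m then i else i - 1"])
       (use \<open>m < d\<close> in \<open>auto simp: s'_def\<close>)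
  moreover have "0 < (-1) ^ m * (\<Prod>i<d-1. s m - s' i)"
    by (rule sign_prod_linear)
       (use \<open>m < d\<close> in \<open>auto simp: s'_def intro!: decreasing_rootsD(3)[OF P]\<close>)
  ultimately show ?thesis
    using decreasing_rootsD(1)[OF P] by (simp add: zero_less_mult_iff mult.left_commute)
qed

lemma decreasing_from_Suc:
  fixes s :: "nat \<Rightarrow> real"
  assumes "\<And>i. Suc i < d \<Longrightarrow> s (Suc i) < s i" and "i < k" and "k < d"
  shows "s k < s i"
  using assms(2,3)
proof (induction k)
  case (Suc k)
  show ?case
  proof (cases "i = k")
    case False
    then have "s k < s i" using Suc by simp
    then show ?thesis using assms(1)[OF Suc.prems(2)] by simp
  qed (use Suc assms(1) in auto)
qed simp

text \<open>
By the intermediate value theorem, \<open>degree Q + 1\<close> points with alternating signs give one root in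
each of the \<open>degree Q\<close> gaps between them, and a polynomial has no room for more roots.
\<close>

lemma decreasing_roots_of_sign_changes:
  fixes Q :: "real poly" and \<sigma> :: "nat \<Rightarrow> real"
  assumes lc: "0 < lead_coeff Q"
    and dec: "\<And>i. i < degree Q \<Longrightarrow> \<sigma> (Suc i) < \<sigma> i"
    and sgn: "\<And>i. i \<le> degree Q \<Longrightarrow> 0 < (-1) ^ i * poly Q (\<sigma> i)"
  obtains r where "decreasing_roots (degree Q) r Q"
    and "\<And>i. i < degree Q \<Longrightarrow> \<sigma> (Suc i) < r i \<and> r i < \<sigma> i"
proof -
  let ?e = "degree Q"
  have "\<exists>x>\<sigma> (Suc i). x < \<sigma> i \<and> poly Q x = 0" if "i < ?e" for i
  proof (rule poly_IVT[OF dec[OF that]])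
    have "0 < (-1) ^ i * poly Q (\<sigma> i)" "0 < (-1) ^ Suc i * poly Q (\<sigma> (Suc i))"
      using sgn[of i] sgn[of "Suc i"] that by auto
    then show "poly Q (\<sigma> (Suc i)) * poly Q (\<sigma> i) < 0"
      by (cases "even i") (auto simp: mult_less_0_iff)
  qed
  then obtain r where r: "\<And>i. i < ?e \<Longrightarrow> \<sigma> (Suc i) < r i \<and> r i < \<sigma> i \<and> poly Q (r i) = 0"
    by metis
  have r_dec: "r k < r i" if "i < k" "k < ?e" for i k
  proof (rule decreasing_from_Suc[OF _ that])
    fix l assume "Suc l < ?e"
    then show "r (Suc l) < r l" using r[of l] r[of "Suc l"] by simp
  qed
  then have "inj_on r {..<?e}"
    by (intro linorder_inj_onI) (auto simp: neq_iff)
  then have "card (r ` {..<?e}) = ?e" by (simp add: card_image)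
  then have "smult (lead_coeff Q) (\<Prod>i<?e. [:- r i, 1:]) = Q"
    by (intro poly_eqI_degree_lead_coeff[where n = ?e and A = "r ` {..<?e}"])
       (use r lead_coeff_prod_linear[of r ?e]
         in \<open>auto simp: degree_prod_linear poly_prod prod_zero_iff\<close>)
  then have "decreasing_roots ?e r Q"
    unfolding decreasing_roots_def using lc r_dec by blast
  then show ?thesis using r that by blast
qed

lemma poly_sign_at_minus_infinity:
  fixes Q :: "real poly"
  assumes "0 < lead_coeff Q"
  obtains m where "\<And>x. x \<le> m \<Longrightarrow> 0 < (-1) ^ degree Q * poly Q x"
proof -
  define R where "R = smult ((-1) ^ degree Q) (pcompose Q [:0, -1:])"
  have "lead_coeff R = lead_coeff Q"
    by (simp add: R_def lead_coeff_comp flip: power_mult_distrib)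
  with assms obtain M where M: "\<And>x. M \<le> x \<Longrightarrow> lead_coeff R \<le> poly R x"
    using poly_pinfty_gt_lc[of R] by auto
  have "0 < (-1) ^ degree Q * poly Q x" if "x \<le> - M" for x
    using M[of "-x"] that assms \<open>lead_coeff R = lead_coeff Q\<close>
    by (simp add: R_def poly_pcompose)
  then show ?thesis using that by blast
qed

section \<open>Strict interlacing\<close>

definition strictly_interlaced :: "real poly \<Rightarrow> real poly \<Rightarrow> bool" where
  "strictly_interlaced P Q \<longleftrightarrow> (\<exists>d e s r. decreasing_roots d s P \<and> decreasing_roots e r Q \<and>
     (e = d \<or> e = Suc d) \<and> (\<forall>i<d. s i < r i) \<and> (\<forall>i. Suc i < e \<longrightarrow> r (Suc i) < s i))"

text \<open>
The criterion on which all interlacing below rests: at the roots of \<open>P\<close>, the sign of \<open>Q\<close> must be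
opposite to that of \<open>P'\<close>, which at the root with index \<open>i\<close> is \<open>(-1)\<^sup>i\<close>. The limits of \<open>Q\<close> at
infinity provide the sign change above the largest root of \<open>P\<close> and, if the degree goes up, the
one below its smallest root.
\<close>

lemma strictly_interlaced_of_signs:
  assumes P: "decreasing_roots d s P"
    and lc: "0 < lead_coeff Q" and deg: "degree Q = d \<or> degree Q = Suc d"
    and sgn: "\<And>i. i < d \<Longrightarrow> (-1) ^ i * poly Q (s i) < 0"
  shows "strictly_interlaced P Q"
proof -
  obtain M0 where M0: "\<And>x. M0 \<le> x \<Longrightarrow> lead_coeff Q \<le> poly Q x"
    using poly_pinfty_gt_lc[OF lc] by auto
  obtain m0 where m0: "\<And>x. x \<le> m0 \<Longrightarrow> 0 < (-1) ^ degree Q * poly Q x"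
    using poly_sign_at_minus_infinity[OF lc] by blast
  \<comment> \<open>\<open>B\<close> and \<open>-B\<close> lie beyond all \<open>s i\<close> and in the regions where the sign of \<open>Q\<close> is settled.\<close>
  define B where "B = Max (insert 0 ((\<lambda>i. \<bar>s i\<bar>) ` {..<d})) + \<bar>M0\<bar> + \<bar>m0\<bar> + 1"
  have sB: "\<bar>s i\<bar> < B" if "i < d" for i
  proof -
    have "\<bar>s i\<bar> \<le> Max (insert 0 ((\<lambda>i. \<bar>s i\<bar>) ` {..<d}))" using that by (intro Max_ge) auto
    then show ?thesis by (simp add: B_def)
  qed
  have "0 \<le> Max (insert 0 ((\<lambda>i. \<bar>s i\<bar>) ` {..<d}))" by (intro Max_ge) auto
  then have B: "0 < B" "M0 \<le> B" "- B \<le> m0" unfolding B_def by linarith+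
  define \<sigma> where "\<sigma> i = (if i = 0 then B else if i \<le> d then s (i - 1) else - B)" for i
  obtain r where r: "decreasing_roots (degree Q) r Q"
    and rs: "\<And>i. i < degree Q \<Longrightarrow> \<sigma> (Suc i) < r i \<and> r i < \<sigma> i"
  proof (rule decreasing_roots_of_sign_changes[OF lc, of \<sigma>])
    fix i assume i: "i < degree Q"
    have "s i < s (i - 1)" if "0 < i" "i < d"
      using that by (intro decreasing_rootsD(3)[OF P]) auto
    then show "\<sigma> (Suc i) < \<sigma> i"
      using sB[of i] sB[of "i - 1"] i deg B by (fastforce simp: \<sigma>_def abs_less_iff)
  next
    fix i assume i: "i \<le> degree Q"
    consider "i = 0" | l where "i = Suc l" "l < d" | "i = Suc d" "degree Q = Suc d"
      using i deg by (cases i) (auto simp: le_less)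
    then show "0 < (-1) ^ i * poly Q (\<sigma> i)"
    proof cases
      case 1
      then show ?thesis using M0[OF B(2)] lc by (simp add: \<sigma>_def)
    next
      case 2
      then show ?thesis using sgn[of l] by (simp add: \<sigma>_def)
    next
      case 3
      then show ?thesis using m0[OF B(3)] by (simp add: \<sigma>_def)
    qed
  qed blast
  have "s i < r i" if "i < d" for i
    using rs[of i] that deg by (auto simp: \<sigma>_def)
  moreover have "r (Suc i) < s i" if "Suc i < degree Q" for i
    using rs[of "Suc i"] that deg by (auto simp: \<sigma>_def)
  ultimately show ?thesis
    unfolding strictly_interlaced_def using P r deg by blast
qed

text \<open>
Conversely, at the roots of \<open>Q\<close> the polynomial \<open>P\<close> has the sign of \<open>Q'\<close>. This turns the
interlacing of one pair of polynomials into signs that can be fed into the criterion for the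
next pair.
\<close>

lemma strictly_interlacedE:
  assumes "strictly_interlaced P Q"
  obtains e r where "decreasing_roots e r Q" and "\<And>i. i < e \<Longrightarrow> 0 < (-1) ^ i * poly P (r i)"
proof -
  from assms obtain d e s r where P: "decreasing_roots d s P" and Q: "decreasing_roots e r Q"
    and de: "e = d \<or> e = Suc d" and sr: "\<And>i. i < d \<Longrightarrow> s i < r i"
    and rs: "\<And>i. Suc i < e \<Longrightarrow> r (Suc i) < s i"
    unfolding strictly_interlaced_def by blast
  have "0 < (-1) ^ i * poly P (r i)" if "i < e" for i
  proof (rule sign_poly_decreasing_roots[OF P])
    show "i \<le> d" using that de by auto
  next
    fix k assume "k < i"
    then have "r i \<le> r (Suc k)"
      using decreasing_rootsD(3)[OF Q, of "Suc k" i] that by (cases "i = Suc k") auto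
    also have "\<dots> < s k" using rs \<open>k < i\<close> that by simp
    finally show "r i < s k" .
  next
    fix k assume k: "i \<le> k" "k < d"
    have "s k < r k" using sr k by simp
    also have "r k \<le> r i"
      using decreasing_rootsD(3)[OF Q, of i k] k de by (cases "i = k") auto
    finally show "s k < r i" .
  qed
  then show ?thesis using Q that by blast
qed

text \<open>
Only the largest root of \<open>Q\<close> can exceed all roots of \<open>P\<close>. If it were positive, it would be the
only root above \<open>0\<close>, and \<open>Q\<close> would be negative there.
\<close>

lemma strictly_interlaced_roots_negative:
  assumes "strictly_interlaced P Q" and neg: "\<And>x. poly P x = 0 \<Longrightarrow> x < 0"
    and "0 < poly Q 0" and "poly Q x = 0"
  shows "x < 0"
proof -
  from assms(1) obtain d e s r where P: "decreasing_roots d s P" and Q: "decreasing_roots e r Q"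
    and de: "e = d \<or> e = Suc d" and rs: "\<And>i. Suc i < e \<Longrightarrow> r (Suc i) < s i"
    unfolding strictly_interlaced_def by blast
  have s: "s i < 0" if "i < d" for i
    using that by (intro neg) (auto simp: poly_eq_0_iff_decreasing_roots[OF P])
  have r: "r i < 0" if "0 < i" "i < e" for i
    using rs[of "i - 1"] s[of "i - 1"] that de by fastforce
  have "r 0 < 0" if "0 < e"
  proof (rule ccontr)
    assume "\<not> r 0 < 0"
    moreover have "r 0 \<noteq> 0"
      using assms(3) poly_eq_0_iff_decreasing_roots[OF Q, of 0] that by force
    ultimately have "0 < r 0" by simp
    then have "0 < (-1) ^ 1 * poly Q 0"
      using that r by (intro sign_poly_decreasing_roots[OF Q]) auto
    then show False using assms(3) by simp
  qed
  then show ?thesis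
    using assms(4) r poly_eq_0_iff_decreasing_roots[OF Q, of x] by (metis gr0I)
qed

section \<open>From root sequences to the relation of interlacing\<close>

lemma map_poly_of_real_mult:
  "map_poly complex_of_real (p * q) = map_poly complex_of_real p * map_poly complex_of_real q"
  by (rule poly_eqI) (simp add: coeff_map_poly coeff_mult)

lemma real_rooted_split:
  fixes s :: "nat \<Rightarrow> real"
  shows "real_rooted (smult c (\<Prod>i<d. [:- s i, 1:]))"
proof (cases "c = 0")
  case False
  have "map_poly complex_of_real (\<Prod>i<d. [:- s i, 1:]) = (\<Prod>i<d. [:- complex_of_real (s i), 1:])"
    by (induction d) (simp_all add: map_poly_of_real_mult map_poly_pCons del: mult_pCons_right)
  then have "map_poly complex_of_real (smult c (\<Prod>i<d. [:- s i, 1:]))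
      = smult (complex_of_real c) (\<Prod>i<d. [:- complex_of_real (s i), 1:])"
    by (simp add: map_poly_smult)
  then show ?thesis
    using False unfolding real_rooted_def by (auto simp: poly_prod prod_zero_iff)
qed (simp add: real_rooted_def)

lemma roots_desc_split:
  fixes s :: "nat \<Rightarrow> real"
  assumes "c \<noteq> 0" and dec: "\<And>i. Suc i < d \<Longrightarrow> s (Suc i) < s i"
  shows "roots_desc (smult c (\<Prod>i<d. [:- s i, 1:])) = map s [0..<d]"
proof -
  have "proots (\<Prod>i<d. [:- s i, 1:]) = (\<Sum>i<d. {#s i#})"
    by (subst proots_prod) auto
  also have "\<dots> = mset (rev (map s [0..<d]))"
    by (induction d) auto
  finally have "proots (smult c (\<Prod>i<d. [:- s i, 1:])) = mset (rev (map s [0..<d]))"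
    using \<open>c \<noteq> 0\<close> by simp
  moreover have "sorted (rev (map s [0..<d]))"
    unfolding sorted_iff_nth_mono_less
    using decreasing_from_Suc[of d s] dec by (simp add: less_imp_le rev_nth)
  ultimately show ?thesis
    unfolding roots_desc_def by (simp only: sorted_list_of_multiset_mset sorted_sort_id rev_rev_ident)
qed

lemma real_rooted_decreasing_roots: "decreasing_roots d s P \<Longrightarrow> real_rooted P"
  by (metis decreasing_roots_def real_rooted_split)

lemma roots_desc_decreasing_roots:
  assumes "decreasing_roots d s P"
  shows "roots_desc P = map s [0..<d]"
proof -
  have P: "smult (lead_coeff P) (\<Prod>i<d. [:- s i, 1:]) = P" and "lead_coeff P \<noteq> 0"
    using assms by (auto simp: decreasing_roots_def)
  have "roots_desc (smult (lead_coeff P) (\<Prod>i<d. [:- s i, 1:])) = map s [0..<d]"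
  proof (rule roots_desc_split[OF \<open>lead_coeff P \<noteq> 0\<close>])
    show "s (Suc i) < s i" if "Suc i < d" for i
      using decreasing_rootsD(3)[OF assms _ that] by blast
  qed
  then show ?thesis unfolding P .
qed

lemma interlaces_of_root_sequences:
  assumes P: "decreasing_roots d s P" and Q: "decreasing_roots e r Q"
    and "e = d \<or> e = Suc d" and "\<And>i. i < d \<Longrightarrow> s i \<le> r i"
    and "\<And>i. Suc i < e \<Longrightarrow> r (Suc i) \<le> s i"
  shows "interlaces P Q"
proof -
  have "interlacing_lists (map s [0..<d]) (map r [0..<e])"
    unfolding interlacing_lists_def using assms(3-) by (auto simp del: upt_Suc)
  then show ?thesis
    unfolding interlaces_def roots_desc_decreasing_roots[OF P] roots_desc_decreasing_roots[OF Q]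
    using real_rooted_decreasing_roots[OF P] real_rooted_decreasing_roots[OF Q] by blast
qed

lemma interlaces_of_strictly_interlaced:
  assumes "strictly_interlaced P Q"
  shows "interlaces P Q"
proof -
  from assms obtain d e s r where "decreasing_roots d s P" "decreasing_roots e r Q"
    "e = d \<or> e = Suc d" "\<And>i. i < d \<Longrightarrow> s i < r i" "\<And>i. Suc i < e \<Longrightarrow> r (Suc i) < s i"
    unfolding strictly_interlaced_def by blast
  then show ?thesis
    by (intro interlaces_of_root_sequences[of d s P e r Q]) (simp_all add: less_imp_le)
qed

text \<open>
The roots of \<open>P\<close> are negative, so the new root \<open>0\<close> is the largest one and all indices move up by
one.
\<close>

lemma decreasing_roots_mult_x:
  assumes P: "decreasing_roots d s P" and neg: "\<And>x. poly P x = 0 \<Longrightarrow> x < 0"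
  shows "decreasing_roots (Suc d) (case_nat 0 s) ([:0, 1:] * P)"
proof -
  have s: "s i < 0" if "i < d" for i
    using that by (intro neg) (auto simp: poly_eq_0_iff_decreasing_roots[OF P])
  have lc: "lead_coeff ([:0, 1:] * P) = lead_coeff P"
    by (subst lead_coeff_mult) simp
  have "smult (lead_coeff P) (\<Prod>i<d. [:- s i, 1:]) = P"
    using P by (simp add: decreasing_roots_def)
  moreover have "(\<Prod>i<Suc d. [:- case_nat 0 s i, 1:]) = [:0, 1:] * (\<Prod>i<d. [:- s i, 1:])"
    by (subst prod.lessThan_Suc_shift) simp
  ultimately have "smult (lead_coeff P) (\<Prod>i<Suc d. [:- case_nat 0 s i, 1:]) = [:0, 1:] * P"
    by (metis mult_smult_right)
  then show ?thesis
    unfolding decreasing_roots_def lc using decreasing_rootsD(1,3)[OF P] s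
    by (auto split: nat.split)
qed

text \<open>
After multiplication by \<open>x\<close> the two polynomials share the root \<open>0\<close>, so that the chain of roots
is no longer strict; it still is a chain because the old roots are negative.
\<close>

lemma interlaces_mult_x:
  assumes "strictly_interlaced P Q"
    and negP: "\<And>x. poly P x = 0 \<Longrightarrow> x < 0" and negQ: "\<And>x. poly Q x = 0 \<Longrightarrow> x < 0"
  shows "interlaces ([:0, 1:] * P) ([:0, 1:] * Q)"
proof -
  from assms(1) obtain d e s r where P: "decreasing_roots d s P" and Q: "decreasing_roots e r Q"
    and de: "e = d \<or> e = Suc d" and sr: "\<And>i. i < d \<Longrightarrow> s i < r i"
    and rs: "\<And>i. Suc i < e \<Longrightarrow> r (Suc i) < s i"
    unfolding strictly_interlaced_def by blast
  have r: "r i < 0" if "i < e" for i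
    using that by (intro negQ) (auto simp: poly_eq_0_iff_decreasing_roots[OF Q])
  show ?thesis
  proof (rule interlaces_of_root_sequences[OF decreasing_roots_mult_x[OF P negP]
        decreasing_roots_mult_x[OF Q negQ]])
    show "Suc e = Suc d \<or> Suc e = Suc (Suc d)" using de by auto
    show "case_nat 0 s i \<le> case_nat 0 r i" if "i < Suc d" for i
      using that sr by (auto split: nat.split intro: less_imp_le)
    show "case_nat 0 r (Suc i) \<le> case_nat 0 s i" if "Suc i < Suc e" for i
      using that rs r by (auto split: nat.split intro: less_imp_le)
  qed auto
qed

section \<open>Coefficients in powers of \<open>x - 1\<close>\<close>

lemma catalan_pos: "0 < catalan m"
  by (simp add: catalan_def)

lemma catalan_Suc: "(real m + 2) * catalan (Suc m) = 2 * (2 * real m + 1) * catalan m"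
proof -
  have "Suc (2 * m + 1) * (2 * m + 1 choose m) = (2 * Suc m choose Suc m) * Suc m"
    using Suc_times_binomial_eq[of "2 * m + 1" m] by simp
  moreover have "Suc m * (2 * m + 1 choose m) = (2 * m + 1) * (2 * m choose m)"
    using binomial_absorb_comp[of "2 * m + 1" m] by simp
  ultimately have "Suc m * (2 * Suc m choose Suc m) = 2 * ((2 * m + 1) * (2 * m choose m))"
    by (simp add: algebra_simps)
  then have "real (Suc m * (2 * Suc m choose Suc m)) = real (2 * ((2 * m + 1) * (2 * m choose m)))"
    by (rule arg_cong)
  then have "(real m + 1) * real (2 * Suc m choose Suc m)
      = 2 * (2 * real m + 1) * real (2 * m choose m)"
    by (simp only: of_nat_mult of_nat_add of_nat_Suc) (simp add: algebra_simps)
  then show ?thesis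
    unfolding catalan_def by (simp add: field_simps del: mult_Suc mult_Suc_right)
qed

text \<open>
The coefficient of \<open>(x - 1)\<^sup>k\<close>. For \<open>2 j \<le> n\<close> the formula describes all coefficients, since the
binomial coefficient is zero as soon as \<open>n < 2 k\<close>.
\<close>

definition toric_coeff :: "nat \<Rightarrow> nat \<Rightarrow> nat \<Rightarrow> real" where
  "toric_coeff n j k = catalan (n - k - j) * real ((n - k) choose k)"

lemma toric_coeff_eq_0: "n < 2 * k \<Longrightarrow> toric_coeff n j k = 0"
  by (simp add: toric_coeff_def binomial_eq_0)

lemma toric_coeff_pos: "2 * k \<le> n \<Longrightarrow> 0 < toric_coeff n j k"
  by (simp add: toric_coeff_def catalan_pos)

definition shifted_toric :: "nat \<Rightarrow> nat \<Rightarrow> real poly" where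
  "shifted_toric n j = (\<Sum>k\<le>n. monom (toric_coeff n j k) k)"

lemma coeff_shifted_toric: "coeff (shifted_toric n j) k = toric_coeff n j k"
  using toric_coeff_eq_0[of n k j]
  by (auto simp: shifted_toric_def coeff_sum coeff_monom if_distrib cong: if_cong)

lemma toric_g_eq_pcompose:
  assumes "2 * j \<le> n"
  shows "toric_g n j = pcompose (shifted_toric n j) [:-1, 1:]"
proof -
  have "pcompose (monom c k) p = smult c (p ^ k)" for c :: real and k p
    by (simp add: pcompose_altdef poly_monom map_poly_monom)
  then have "pcompose (shifted_toric n j) [:-1, 1:]
      = (\<Sum>k\<le>n. smult (toric_coeff n j k) ([:-1, 1:] ^ k))"
    by (simp add: shifted_toric_def pcompose_sum)
  also have "\<dots> = (\<Sum>k = 0..n div 2. smult (toric_coeff n j k) ([:-1, 1:] ^ k))"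
    by (rule sum.mono_neutral_right) (auto intro!: toric_coeff_eq_0)
  also have "n div 2 = min (n div 2) (n - j)" using assms by auto
  finally show ?thesis by (simp add: toric_g_def toric_coeff_def)
qed

lemma degree_toric_g:
  assumes "2 * j \<le> n"
  shows "degree (toric_g n j) = n div 2" and "0 < lead_coeff (toric_g n j)"
proof -
  have "degree (shifted_toric n j) \<le> n div 2"
    by (rule degree_le) (auto simp: coeff_shifted_toric intro!: toric_coeff_eq_0)
  moreover have "coeff (shifted_toric n j) (n div 2) > 0"
    by (simp add: coeff_shifted_toric toric_coeff_pos)
  ultimately have "degree (shifted_toric n j) = n div 2"
    by (metis le_antisym le_degree less_irrefl)
  moreover from this have "0 < lead_coeff (shifted_toric n j)"
    by (simp add: coeff_shifted_toric toric_coeff_pos)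
  moreover have "lead_coeff (pcompose (shifted_toric n j) [:-1, 1:]) = lead_coeff (shifted_toric n j)"
    by (subst lead_coeff_comp) auto
  ultimately show "degree (toric_g n j) = n div 2" "0 < lead_coeff (toric_g n j)"
    unfolding toric_g_eq_pcompose[OF assms] by (simp_all add: degree_pcompose)
qed

section \<open>Two recurrences\<close>

text \<open>
The Catalan number is the same in all three terms, so this is Pascal's rule.
\<close>

lemma toric_coeff_pascal:
  assumes "1 \<le> n"
  shows "toric_coeff (n + 1) (j + 1) (Suc k) = toric_coeff n j (Suc k) + toric_coeff (n - 1) j k"
proof (cases "k < n")
  case True
  then obtain N where "n = Suc (k + N)" by (metis less_imp_Suc_add add_Suc_right)
  then show ?thesis by (simp add: toric_coeff_def algebra_simps Suc_diff_le)
next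
  case False
  then have "n < Suc k" "n + 1 < 2 * Suc k" "n < 2 * Suc k" "n - 1 < 2 * k" using assms by auto
  then show ?thesis by (simp add: toric_coeff_eq_0)
qed

text \<open>
With \<open>N = n - k - 1\<close> and \<open>m = N - j\<close>, only the Catalan numbers \<open>C(m)\<close> and \<open>C(m + 1)\<close> occur.
Absorption, \<open>(n - 2 k) binom(N + 1, k) = (k + 1) binom(N + 1, k + 1)\<close>, moves the second term on
the right to the left and leaves the factor \<open>m + 2\<close> there, which is just what the recurrence for
\<open>C(m + 1)\<close> needs. What remains is a relation between \<open>binom(N, k)\<close> and \<open>binom(N, k + 1)\<close>,
absorption once more.
\<close>

lemma toric_coeff_rec:
  assumes "2 * j \<le> n"
  shows "(real n - real j + 2) * toric_coeff (n + 1) j (Suc k) =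
    (4 * (real n - real j) + 2 - 2 * (real k + 1)) * toric_coeff n j (Suc k)
    + (real n - 2 * real k) * toric_coeff n j k
    + 2 * (real n - 2 * real j) * toric_coeff (n - 1) j k"
proof (cases "2 * k < n")
  case True
  define N where "N = n - Suc k"
  define m where "m = N - j"
  have n: "n = Suc k + N" and N: "N = j + m" and "k \<le> N"
    using True assms by (auto simp: N_def m_def)
  define c where "c = catalan m"
  define c' where "c' = catalan (Suc m)"
  define b where "b = real (N choose k)"
  define b0 where "b0 = real (N choose Suc k)"
  define b1 where "b1 = real (Suc N choose k)"
  have coeffs: "toric_coeff (n + 1) j (Suc k) = c' * (b + b0)" "toric_coeff n j (Suc k) = c * b0"
    "toric_coeff n j k = c' * b1" "toric_coeff (n - 1) j k = c * b"
    by (simp_all add: toric_coeff_def c_def c'_def b_def b0_def b1_def n N)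
  have cat: "(real m + 2) * c' = 2 * (2 * real m + 1) * c"
    by (simp add: c_def c'_def catalan_Suc)
  have "real ((N - k) * (N choose k)) = real (Suc k * (N choose Suc k))"
    by (simp only: binomial_absorption binomial_absorb_comp)
  then have low: "(real N - real k) * b = (real k + 1) * b0"
    using \<open>k \<le> N\<close> by (simp add: b_def b0_def of_nat_diff algebra_simps)
  have "real ((Suc N - k) * (Suc N choose k)) = real (Suc k * (Suc N choose Suc k))"
    by (simp only: binomial_absorption binomial_absorb_comp)
  have high: "(real N + 1 - real k) * b1 = (real k + 1) * (b + b0)"
  proof -
    have "real (Suc N - k) = real N + 1 - real k" using \<open>k \<le> N\<close> by (simp add: of_nat_diff)
    moreover have "real (Suc k) = real k + 1" "real (Suc N choose Suc k) = b + b0"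
      by (simp_all add: b_def b0_def)
    ultimately show ?thesis
      using \<open>real ((Suc N - k) * _) = _\<close> by (simp only: of_nat_mult b1_def)
  qed
  have rN: "real N = real j + real m" and rn: "real n = real k + 1 + (real j + real m)"
    by (simp_all add: n N)
  show ?thesis
    unfolding coeffs rn using low high cat unfolding rN by algebra
next
  case False
  then have "toric_coeff (n + 1) j (Suc k) = 0" "toric_coeff n j (Suc k) = 0"
    by (simp_all add: toric_coeff_eq_0)
  moreover have "(real n - 2 * real k) * toric_coeff n j k = 0"
    using False toric_coeff_eq_0[of n k j] by (cases "n = 2 * k") auto
  moreover have "(real n - 2 * real j) * toric_coeff (n - 1) j k = 0"
    using False assms toric_coeff_eq_0[of "n - 1" k j] by (cases "n = 0") auto
  ultimately show ?thesis by (simp only: mult.assoc)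
qed

lemma toric_g_pascal:
  assumes "2 * j + 1 \<le> n"
  shows "toric_g (n + 1) (j + 1) = toric_g n j + [:-1, 1:] * toric_g (n - 1) j"
proof -
  have "shifted_toric (n + 1) (j + 1) = shifted_toric n j + [:0, 1:] * shifted_toric (n - 1) j"
  proof (rule poly_eqI)
    fix k
    show "coeff (shifted_toric (n + 1) (j + 1)) k
        = coeff (shifted_toric n j + [:0, 1:] * shifted_toric (n - 1) j) k"
      using toric_coeff_pascal[of n j] assms
      by (cases k) (simp_all add: coeff_shifted_toric toric_coeff_def)
  qed
  then have "pcompose (shifted_toric (n + 1) (j + 1)) [:-1, 1:]
      = pcompose (shifted_toric n j + [:0, 1:] * shifted_toric (n - 1) j) [:-1, 1:]"
    by (rule arg_cong)
  then show ?thesis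
    using assms
    by (simp add: toric_g_eq_pcompose pcompose_add pcompose_mult pcompose_pCons del: mult_pCons_left)
qed

text \<open>
The engine of the proof. At a root \<open>\<alpha> < 0\<close> of \<open>g(n, j)\<close> the first term on the right vanishes and
the factors \<open>- \<alpha> (\<alpha> - 1)\<close> and \<open>\<alpha> - 1\<close> of the other two are negative, while \<open>n - 2 j \<ge> 0\<close>. So if
\<open>g(n - 1, j)\<close> has the sign of the derivative of \<open>g(n, j)\<close> at \<open>\<alpha>\<close>, then \<open>g(n + 1, j)\<close> has the
opposite sign. For \<open>n = 2 j\<close> the last term disappears, so that the induction on \<open>n\<close> can start
there.
\<close>

lemma toric_g_rec:
  assumes "2 * j \<le> n"
  shows "smult (real n - real j + 2) (toric_g (n + 1) j) =
    [:4 * (real n - real j) + 2 - real n, real n:] * toric_g n j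
    - smult 2 ([:0, -1, 1:] * pderiv (toric_g n j))
    + smult (2 * (real n - 2 * real j)) ([:-1, 1:] * toric_g (n - 1) j)"
proof -
  let ?G = "shifted_toric" and ?a = "real n - real j"
  have rec: "smult (?a + 2) (?G (n + 1) j) = [:4 * ?a + 2, real n:] * ?G n j
      - smult 2 ([:0, 1, 1:] * pderiv (?G n j))
      + smult (2 * (real n - 2 * real j)) ([:0, 1:] * ?G (n - 1) j)"
  proof (rule poly_eqI)
    fix k
    show "coeff (smult (?a + 2) (?G (n + 1) j)) k = coeff ([:4 * ?a + 2, real n:] * ?G n j
      - smult 2 ([:0, 1, 1:] * pderiv (?G n j))
      + smult (2 * (real n - 2 * real j)) ([:0, 1:] * ?G (n - 1) j)) k"
    proof (cases k)
      case 0
      have "(?a + 2) * catalan (n + 1 - j) = (4 * ?a + 2) * catalan (n - j)"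
        using catalan_Suc[of "n - j"] assms by (simp add: of_nat_diff Suc_diff_le)
      then show ?thesis by (simp add: 0 coeff_shifted_toric toric_coeff_def)
    next
      case (Suc l)
      have "coeff (pCons 0 (pderiv (?G n j))) l = real l * toric_coeff n j l"
        by (cases l) (simp_all add: coeff_pderiv coeff_shifted_toric)
      then show ?thesis
        using toric_coeff_rec[OF assms, of l]
        by (simp add: Suc coeff_shifted_toric coeff_pderiv algebra_simps)
    qed
  qed
  let ?x = "[:-1, 1:] :: real poly"
  have d: "pderiv (toric_g n j) = pcompose (pderiv (?G n j)) ?x"
    by (simp add: toric_g_eq_pcompose[OF assms] pderiv_pcompose pderiv_pCons)
  have last: "smult (2 * (real n - 2 * real j)) (?x * toric_g (n - 1) j)
      = smult (2 * (real n - 2 * real j)) (?x * pcompose (?G (n - 1) j) ?x)"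
  proof (cases "n = 2 * j")
    case False
    then show ?thesis using assms by (subst toric_g_eq_pcompose) auto
  qed simp
  have lin: "pcompose [:4 * ?a + 2, real n:] ?x = [:4 * ?a + 2 - real n, real n:]"
    "pcompose [:0, 1, 1:] ?x = [:0, -1, 1:]" "pcompose [:0, 1:] ?x = ?x"
    by (simp_all add: pcompose_pCons)
  have "pcompose (smult (?a + 2) (?G (n + 1) j)) ?x = pcompose ([:4 * ?a + 2, real n:] * ?G n j
      - smult 2 ([:0, 1, 1:] * pderiv (?G n j))
      + smult (2 * (real n - 2 * real j)) ([:0, 1:] * ?G (n - 1) j)) ?x"
    unfolding rec ..
  then show ?thesis
    unfolding d last using assms
    by (simp only: pcompose_add pcompose_diff pcompose_smult pcompose_mult lin
        toric_g_eq_pcompose[OF assms] toric_g_eq_pcompose[of j "n + 1"] trans_le_add1)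
qed

section \<open>Removing the root \<open>x = 0\<close>\<close>

text \<open>
The recurrence preserves both values, and for \<open>j > 0\<close> the value at the start \<open>n = 2 j\<close> is a
difference of two equal values of \<open>g(m, j - 1)\<close> for neighbouring \<open>m\<close>.
\<close>

lemma poly_toric_g_0:
  assumes "2 * j \<le> n"
  shows "poly (toric_g n j) 0 = (if j = 0 then 1 else 0)"
  using assms
proof (induction j arbitrary: n)
  case 0
  show ?case
  proof (induction n rule: less_induct)
    case (less n)
    show ?case
    proof (cases n)
      case 0
      then show ?thesis by (simp add: toric_g_def catalan_def)
    next
      case (Suc m)
      have "(real m + 2) * poly (toric_g n 0) 0
          = (3 * real m + 2) * poly (toric_g m 0) 0 - 2 * real m * poly (toric_g (m - 1) 0) 0"
        using arg_cong[OF toric_g_rec[of 0 m], of "\<lambda>p. poly p 0"] by (simp add: Suc algebra_simps)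
      also have "\<dots> = real m + 2"
        using less[of m] less[of "m - 1"] Suc by simp
      finally show ?thesis by simp
    qed
  qed
next
  case (Suc j)
  have "poly (toric_g n (Suc j)) 0 = 0"
    using \<open>2 * Suc j \<le> n\<close>
  proof (induction n rule: less_induct)
    case (less n)
    then obtain m where n: "n = Suc m" by (cases n) auto
    show ?case
    proof (cases "n = 2 * Suc j")
      case True
      then have "m = 2 * j + 1" using n by simp
      then have "toric_g n (Suc j) = toric_g m j + [:-1, 1:] * toric_g (m - 1) j"
        using toric_g_pascal[of j m] n by simp
      then show ?thesis
        using Suc.IH[of m] Suc.IH[of "m - 1"] \<open>m = 2 * j + 1\<close> by simp
    next
      case False
      then have m: "2 * Suc j \<le> m" using less n by simp
      have z: "(real m - 2 * real (Suc j)) * poly (toric_g (m - 1) (Suc j)) 0 = 0"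
        using less(1)[of "m - 1"] n m by (cases "m = 2 * Suc j") auto
      have "(real m - real (Suc j) + 2) * poly (toric_g (m + 1) (Suc j)) 0 = 0"
        using arg_cong[OF toric_g_rec[OF m], of "\<lambda>p. poly p 0"] less(1)[of m] n m z
        by (simp add: mult.assoc del: of_nat_Suc)
      moreover have "real m - real (Suc j) + 2 \<noteq> 0"
        using of_nat_mono[OF m, where 'a = real] by simp
      ultimately show ?thesis using n by simp
    qed
  qed
  then show ?case by simp
qed

text \<open>
For \<open>j > 0\<close> all \<open>g(n, j)\<close> have the root \<open>0\<close>, where the recurrence yields no strict sign.
Dividing it out leaves polynomials with simple negative roots that interlace strictly.
\<close>

definition toric_core :: "nat \<Rightarrow> nat \<Rightarrow> real poly" where
  "toric_core n j = (if j = 0 then toric_g n j else toric_g n j div [:0, 1:])"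

lemma toric_core_0: "toric_core n 0 = toric_g n 0"
  by (simp add: toric_core_def)

lemma toric_g_eq_x_times_core:
  assumes "2 * j \<le> n" and "0 < j"
  shows "toric_g n j = [:0, 1:] * toric_core n j"
proof -
  have "[:0, 1:] dvd toric_g n j"
    using poly_toric_g_0[OF assms(1)] assms(2) poly_eq_0_iff_dvd[of "toric_g n j" 0] by simp
  then show ?thesis using assms(2) by (simp add: toric_core_def del: mult_pCons_left)
qed

lemma degree_toric_core:
  assumes "2 * j \<le> n"
  shows "degree (toric_core n j) = n div 2 - (if j = 0 then 0 else 1)"
    and "0 < lead_coeff (toric_core n j)"
proof -
  consider "j = 0" | "0 < j" by blast
  then have "degree (toric_core n j) = n div 2 - (if j = 0 then 0 else 1) \<and>
    0 < lead_coeff (toric_core n j)"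
  proof cases
    case 1
    then show ?thesis using degree_toric_g[OF assms] by (simp add: toric_core_0)
  next
    case 2
    have g: "toric_g n j = [:0, 1:] * toric_core n j" by (rule toric_g_eq_x_times_core[OF assms 2])
    have "toric_core n j \<noteq> 0"
      using degree_toric_g(2)[OF assms] unfolding g by auto
    then have "degree (toric_g n j) = Suc (degree (toric_core n j))"
      unfolding g by (subst degree_mult_eq) auto
    moreover have "lead_coeff (toric_g n j) = lead_coeff (toric_core n j)"
      unfolding g by (subst lead_coeff_mult) simp
    ultimately show ?thesis using degree_toric_g[OF assms] 2 by simp
  qed
  then show "degree (toric_core n j) = n div 2 - (if j = 0 then 0 else 1)"
    "0 < lead_coeff (toric_core n j)" by auto
qed

text \<open>
The product rule for \<open>x P\<close> contributes \<open>- 2 (x - 1) P\<close>, which only changes the factor of \<open>P\<close>;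
the terms that decide the sign at a root of \<open>P\<close> stay the same.
\<close>

lemma toric_core_rec:
  fixes n j :: nat
  defines "e \<equiv> if j = 0 then 0 else (1::real)"
  assumes "2 * j \<le> n"
  shows "smult (real n - real j + 2) (toric_core (n + 1) j) =
    [:4 * (real n - real j) + 2 - real n + 2 * e, real n - 2 * e:] * toric_core n j
    - smult 2 ([:0, -1, 1:] * pderiv (toric_core n j))
    + smult (2 * (real n - 2 * real j)) ([:-1, 1:] * toric_core (n - 1) j)"
proof (cases "j = 0")
  case True
  then show ?thesis using toric_g_rec[OF assms(2)] by (simp add: toric_core_0 e_def)
next
  case False
  let ?P = "toric_core n j" and ?Q = "toric_core (n + 1) j" and ?R = "toric_core (n - 1) j"
  let ?c = "2 * (real n - 2 * real j)" and ?x = "[:0, 1:] :: real poly"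
  have P: "toric_g n j = ?x * ?P" and Q: "toric_g (n + 1) j = ?x * ?Q"
    using False assms(2) by (simp_all only: toric_g_eq_x_times_core trans_le_add1 neq0_conv)
  have R: "smult ?c ([:-1, 1:] * toric_g (n - 1) j) = smult ?c ([:-1, 1:] * (?x * ?R))"
  proof (cases "n = 2 * j")
    case n: False
    then show ?thesis using assms(2) False by (subst toric_g_eq_x_times_core) auto
  qed simp
  have pd: "pderiv (toric_g n j) = ?P + ?x * pderiv ?P"
    unfolding P by (simp add: pderiv_mult pderiv_pCons del: mult_pCons_left)
  have "?x * smult (real n - real j + 2) ?Q
      = ?x * ([:4 * (real n - real j) + 2 - real n + 2 * e, real n - 2 * e:] * ?P
      - smult 2 ([:0, -1, 1:] * pderiv ?P) + smult ?c ([:-1, 1:] * ?R))"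
  proof -
    have "?x * smult (real n - real j + 2) ?Q = smult (real n - real j + 2) (toric_g (n + 1) j)"
      unfolding Q by (simp only: mult_smult_right)
    also have "\<dots> = [:4 * (real n - real j) + 2 - real n, real n:] * (?x * ?P)
        - smult 2 ([:0, -1, 1:] * (?P + ?x * pderiv ?P)) + smult ?c ([:-1, 1:] * (?x * ?R))"
      unfolding toric_g_rec[OF assms(2)] R pd unfolding P ..
    also have "\<dots> = ?x * ([:4 * (real n - real j) + 2 - real n + 2 * e, real n - 2 * e:] * ?P
      - smult 2 ([:0, -1, 1:] * pderiv ?P) + smult ?c ([:-1, 1:] * ?R))"
      using False by (intro poly_eq_poly_eq_iff[THEN iffD1] ext) (simp add: e_def algebra_simps)
    finally show ?thesis .
  qed
  then show ?thesis by (subst (asm) mult_cancel_left) simp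
qed

lemma toric_core_pascal:
  assumes "2 * j + 1 \<le> n" and "0 < j"
  shows "toric_core (n + 1) (j + 1) = toric_core n j + [:-1, 1:] * toric_core (n - 1) j"
proof -
  let ?x = "[:0, 1:] :: real poly"
  have "?x * toric_core (n + 1) (j + 1) = toric_g (n + 1) (j + 1)"
    using assms by (intro toric_g_eq_x_times_core[symmetric]) auto
  also have "\<dots> = toric_g n j + [:-1, 1:] * toric_g (n - 1) j"
    by (rule toric_g_pascal[OF assms(1)])
  also have "\<dots> = ?x * toric_core n j + [:-1, 1:] * (?x * toric_core (n - 1) j)"
    using assms toric_g_eq_x_times_core[of j n] toric_g_eq_x_times_core[of j "n - 1"] by auto
  also have "\<dots> = ?x * (toric_core n j + [:-1, 1:] * toric_core (n - 1) j)"
    by (simp only: distrib_left mult.left_commute)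
  finally show ?thesis by (subst (asm) mult_cancel_left) simp
qed

lemma toric_core_2_1: "toric_core 2 1 = 1"
proof -
  have g0: "toric_g 0 0 = 1" "toric_g 1 0 = 1"
    by (simp_all add: toric_g_def catalan_def one_pCons)
  have "[:0, 1:] * toric_core 2 1 = toric_g 2 1"
    by (rule toric_g_eq_x_times_core[symmetric]) auto
  also have "\<dots> = [:0, 1:] * 1"
    using toric_g_pascal[of 0 1] g0 by (simp add: numeral_2_eq_2 one_pCons)
  finally show ?thesis by (subst (asm) mult_cancel_left) simp
qed

text \<open>
The recurrence at \<open>x = 0\<close> involves only values at \<open>0\<close>, because the factor of the derivative
vanishes there. Given that the value doubles from \<open>n - 1\<close> to \<open>n\<close>, it shows that the value
doubles again; for \<open>n = 2 j\<close> it shows this outright.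
\<close>

lemma poly_toric_core_0_Suc:
  assumes "2 * j \<le> n" and "0 < j"
  shows "poly (toric_core (n + 1) j) 0 = 2 * poly (toric_core n j) 0"
  using assms(1)
proof (induction n rule: nat_induct_at_least)
  case base
  have "(real j + 2) * poly (toric_core (2 * j + 1) j) 0
      = (real j + 2) * (2 * poly (toric_core (2 * j) j) 0)"
    using arg_cong[OF toric_core_rec[of j "2 * j"], of "\<lambda>p. poly p 0"] assms(2)
    by (simp add: algebra_simps)
  then show ?case by (subst (asm) mult_cancel_left) simp
next
  case (Suc n)
  let ?q = "poly (toric_core (Suc n + 1) j) 0" and ?p = "poly (toric_core (Suc n) j) 0"
  have r: "poly (toric_core n j) 0 = ?p / 2" using Suc.IH by simp
  have "(real n - real j + 3) * ?q = (real n - real j + 3) * (2 * ?p)"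
    using arg_cong[OF toric_core_rec[of j "Suc n"], of "\<lambda>p. poly p 0"] assms(2) Suc.hyps r
    by (simp add: algebra_simps add_divide_distrib)
  moreover have "real n - real j + 3 \<noteq> 0" using Suc.hyps by linarith
  ultimately show ?case by simp
qed

lemma poly_toric_core_0_pos:
  assumes "2 * j \<le> n"
  shows "0 < poly (toric_core n j) 0"
proof (cases "j = 0")
  case True
  then show ?thesis using poly_toric_g_0[of 0 n] by (simp add: toric_core_0)
next
  case False
  have diagonal: "0 < poly (toric_core (2 * j) j) 0" if "0 < j" for j
    using that
  proof (induction j rule: nat_induct_non_zero)
    case 1
    then show ?case using toric_core_2_1 by simp
  next
    case (Suc j)
    have "toric_core (2 * Suc j) (Suc j)
        = toric_core (2 * j + 1) j + [:-1, 1:] * toric_core (2 * j) j"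
      using toric_core_pascal[of j "2 * j + 1"] Suc.hyps by simp
    then show ?case
      using poly_toric_core_0_Suc[of j "2 * j"] Suc by simp
  qed
  show ?thesis
    using assms
  proof (induction n rule: nat_induct_at_least)
    case base
    show ?case using False diagonal by simp
  next
    case (Suc n)
    then show ?case using poly_toric_core_0_Suc[of j n] False by simp
  qed
qed

section \<open>Interlacing of the toric polynomials\<close>

text \<open>
At a root \<open>\<alpha> < 0\<close> of \<open>P\<close>, the value of \<open>Q\<close> is \<open>(\<alpha> - 1) R(\<alpha>)\<close>, whose sign is opposite to that of
\<open>R(\<alpha>)\<close> and thus of \<open>P'(\<alpha>)\<close>.
\<close>

lemma strictly_interlaced_add:
  assumes RP: "strictly_interlaced R P" and neg: "\<And>x. poly P x = 0 \<Longrightarrow> x < 0"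
    and Q: "Q = P + [:-1, 1:] * R" and "0 < lead_coeff Q"
    and "degree Q = degree P \<or> degree Q = Suc (degree P)"
  shows "strictly_interlaced P Q"
proof -
  obtain d s where P: "decreasing_roots d s P"
    and R: "\<And>i. i < d \<Longrightarrow> 0 < (-1) ^ i * poly R (s i)"
    using strictly_interlacedE[OF RP] by blast
  show ?thesis
  proof (rule strictly_interlaced_of_signs[OF P assms(4)])
    show "degree Q = d \<or> degree Q = Suc d"
      using assms(5) degree_decreasing_roots[OF P] by simp
  next
    fix i assume "i < d"
    then have root: "poly P (s i) = 0" by (auto simp: poly_eq_0_iff_decreasing_roots[OF P])
    have "(-1) ^ i * poly Q (s i) = (s i - 1) * ((-1) ^ i * poly R (s i))"
      using root by (simp add: Q algebra_simps)
    also have "\<dots> < 0"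
      using neg[OF root] R[OF \<open>i < d\<close>] by (intro mult_neg_pos) auto
    finally show "(-1) ^ i * poly Q (s i) < 0" .
  qed
qed

text \<open>
The sign argument for the recurrence. The signs of the preceding polynomial are assumed only for
\<open>2 j < n\<close>, as its coefficient \<open>n - 2 j\<close> is zero at the start of the induction.
\<close>

lemma toric_core_step:
  assumes nj: "2 * j \<le> n" and P: "decreasing_roots d s (toric_core n j)"
    and neg: "\<And>x. poly (toric_core n j) x = 0 \<Longrightarrow> x < 0"
    and R: "\<And>i. 2 * j < n \<Longrightarrow> i < d \<Longrightarrow> 0 < (-1) ^ i * poly (toric_core (n - 1) j) (s i)"
  shows "strictly_interlaced (toric_core n j) (toric_core (n + 1) j)"
proof (rule strictly_interlaced_of_signs[OF P])
  show "0 < lead_coeff (toric_core (n + 1) j)"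
    using nj by (intro degree_toric_core(2)) simp
  show "degree (toric_core (n + 1) j) = d \<or> degree (toric_core (n + 1) j) = Suc d"
    using degree_toric_core(1)[of j n] degree_toric_core(1)[of j "n + 1"]
      degree_decreasing_roots[OF P] nj by (cases "j = 0") (simp_all, linarith+)
next
  fix i assume "i < d"
  let ?P = "toric_core n j" and ?Q = "toric_core (n + 1) j" and ?R = "toric_core (n - 1) j"
  let ?a = "s i" and ?\<epsilon> = "(-1::real) ^ i"
  have root: "poly ?P ?a = 0"
    using \<open>i < d\<close> by (auto simp: poly_eq_0_iff_decreasing_roots[OF P])
  then have "?a < 0" by (rule neg)
  have rec: "(real n - real j + 2) * poly ?Q ?a
      = - 2 * (?a * (?a - 1)) * poly (pderiv ?P) ?a
        + 2 * (real n - 2 * real j) * (?a - 1) * poly ?R ?a"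
    using arg_cong[OF toric_core_rec[OF nj], of "\<lambda>p. poly p ?a"] root
    by (simp add: algebra_simps)
  have "(real n - real j + 2) * (?\<epsilon> * poly ?Q ?a) = ?\<epsilon> * ((real n - real j + 2) * poly ?Q ?a)"
    by simp
  also have "\<dots> = - 2 * (?a * (?a - 1)) * (?\<epsilon> * poly (pderiv ?P) ?a)
        + 2 * (?a - 1) * ((real n - 2 * real j) * (?\<epsilon> * poly ?R ?a))"
    unfolding rec by (simp add: algebra_simps)
  also have "\<dots> < 0"
  proof (rule add_neg_nonpos)
    have "0 < ?a * (?a - 1)" using \<open>?a < 0\<close> by (intro mult_neg_neg) auto
    then show "- 2 * (?a * (?a - 1)) * (?\<epsilon> * poly (pderiv ?P) ?a) < 0"
      using sign_pderiv_decreasing_roots[OF P \<open>i < d\<close>] by (intro mult_neg_pos) auto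
    have "0 \<le> (real n - 2 * real j) * (?\<epsilon> * poly ?R ?a)"
    proof (cases "n = 2 * j")
      case False
      then have "2 * j < n" using nj by simp
      then show ?thesis
        using R[OF _ \<open>i < d\<close>] by (intro mult_nonneg_nonneg[OF _ less_imp_le]) auto
    qed simp
    then show "2 * (?a - 1) * ((real n - 2 * real j) * (?\<epsilon> * poly ?R ?a)) \<le> 0"
      using \<open>?a < 0\<close> by (intro mult_nonpos_nonneg[of "2 * (?a - 1)"]) auto
  qed
  finally have "(real n - real j + 2) * (?\<epsilon> * poly ?Q ?a) < 0" .
  moreover have "0 < real n - real j + 2" using nj by linarith
  ultimately show "?\<epsilon> * poly ?Q ?a < 0" by (simp add: mult_less_0_iff)
qed

text \<open>
Interlacing with the predecessor gives the signs that the next step needs, and the positive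
value at \<open>0\<close> keeps the roots negative.
\<close>

lemma toric_core_interlaced_from_base:
  assumes "decreasing_roots d s (toric_core (2 * j) j)"
    and neg: "\<And>x. poly (toric_core (2 * j) j) x = 0 \<Longrightarrow> x < 0" and "2 * j \<le> n"
  shows "strictly_interlaced (toric_core n j) (toric_core (n + 1) j) \<and>
    (\<forall>x. poly (toric_core n j) x = 0 \<longrightarrow> x < 0)"
  using assms(3)
proof (induction n rule: nat_induct_at_least)
  case base
  show ?case using toric_core_step[OF _ assms(1) neg] neg by auto
next
  case (Suc n)
  then have si: "strictly_interlaced (toric_core n j) (toric_core (n + 1) j)" by blast
  have negQ: "x < 0" if "poly (toric_core (n + 1) j) x = 0" for x
    using strictly_interlaced_roots_negative[OF si _ _ that] Suc poly_toric_core_0_pos[of j "n + 1"]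
    by simp
  obtain e r where "decreasing_roots e r (toric_core (n + 1) j)"
    and "\<And>i. i < e \<Longrightarrow> 0 < (-1) ^ i * poly (toric_core n j) (r i)"
    using strictly_interlacedE[OF si] by blast
  then have "strictly_interlaced (toric_core (n + 1) j) (toric_core (n + 1 + 1) j)"
    using Suc.hyps negQ by (intro toric_core_step) auto
  then show ?case using negQ by simp
qed

text \<open>
Induction on \<open>j\<close> provides the starting point \<open>n = 2 j\<close> of the induction on \<open>n\<close>: Pascal's rule
writes this polynomial in terms of two neighbours with parameter \<open>j - 1\<close>, which interlace
already. The case \<open>j = 1\<close> is started separately, because Pascal's rule leads from \<open>j = 0\<close>, where
\<open>0\<close> is not a root, to \<open>j = 1\<close>, where it is; there the core is the constant \<open>1\<close>.
\<close>

lemma toric_core_interlaced: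
  assumes "2 * j \<le> n"
  shows "strictly_interlaced (toric_core n j) (toric_core (n + 1) j)"
    and "poly (toric_core n j) x = 0 \<Longrightarrow> x < 0"
proof -
  have "\<exists>d s. decreasing_roots d s (toric_core (2 * j) j) \<and>
      (\<forall>x. poly (toric_core (2 * j) j) x = 0 \<longrightarrow> x < 0)"
  proof (induction j)
    case 0
    have "toric_core (2 * 0) 0 = 1"
      by (simp add: toric_core_0 toric_g_def catalan_def one_pCons)
    then show ?case using decreasing_roots_1 by auto
  next
    case (Suc j)
    show ?case
    proof (cases "j = 0")
      case True
      then show ?thesis using decreasing_roots_1 toric_core_2_1 by auto
    next
      case False
      let ?R = "toric_core (2 * j) j" and ?P = "toric_core (2 * j + 1) j"
        and ?Q = "toric_core (2 * Suc j) (Suc j)"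
      obtain d s where ds: "decreasing_roots d s ?R" "\<And>x. poly ?R x = 0 \<Longrightarrow> x < 0"
        using Suc.IH by blast
      have RP: "strictly_interlaced ?R ?P"
        using toric_core_interlaced_from_base[OF ds] by simp
      have negP: "x < 0" if "poly ?P x = 0" for x
        using toric_core_interlaced_from_base[OF ds, of "2 * j + 1"] that by simp
      have "?Q = ?P + [:-1, 1:] * ?R"
        using toric_core_pascal[of j "2 * j + 1"] False by simp
      moreover have "0 < lead_coeff ?Q" by (rule degree_toric_core) simp
      moreover have "degree ?Q = degree ?P \<or> degree ?Q = Suc (degree ?P)"
        using False degree_toric_core(1)[of "Suc j" "2 * Suc j"]
          degree_toric_core(1)[of j "2 * j + 1"]
        by auto
      ultimately have PQ: "strictly_interlaced ?P ?Q"
        by (rule strictly_interlaced_add[OF RP, rotated]) (rule negP)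
      have "x < 0" if "poly ?Q x = 0" for x
        using strictly_interlaced_roots_negative[OF PQ negP poly_toric_core_0_pos that] by simp
      then show ?thesis using strictly_interlacedE[OF PQ] by metis
    qed
  qed
  then show "strictly_interlaced (toric_core n j) (toric_core (n + 1) j)"
    "poly (toric_core n j) x = 0 \<Longrightarrow> x < 0"
    using toric_core_interlaced_from_base[OF _ _ assms] by blast+
qed

lemma toric_g_interlaces_Suc:
  assumes "2 * j \<le> n"
  shows "interlaces (toric_g n j) (toric_g (n + 1) j)"
proof (cases "j = 0")
  case True
  then show ?thesis
    using interlaces_of_strictly_interlaced[OF toric_core_interlaced(1)[OF assms]]
    by (simp add: toric_core_0)
next
  case False
  then have "toric_g n j = [:0, 1:] * toric_core n j"
    "toric_g (n + 1) j = [:0, 1:] * toric_core (n + 1) j"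
    using assms by (simp_all only: toric_g_eq_x_times_core trans_le_add1 neq0_conv)
  moreover have "interlaces ([:0, 1:] * toric_core n j) ([:0, 1:] * toric_core (n + 1) j)"
    using assms by (intro interlaces_mult_x toric_core_interlaced) auto
  ultimately show ?thesis by simp
qed

text \<open>
For \<open>j = 0\<close> the roots of \<open>g(n, 0)\<close> are negative, so that Pascal's rule can be used for the full
polynomials, with \<open>0\<close> as the largest root of the second one. For \<open>j > 0\<close> both have the root \<open>0\<close>,
and Pascal's rule is used for the cores.
\<close>

lemma toric_g_interlaces_Suc_Suc:
  assumes "2 * j + 1 \<le> n"
  shows "interlaces (toric_g n j) (toric_g (n + 1) (j + 1))"
proof -
  have RP: "strictly_interlaced (toric_core (n - 1) j) (toric_core n j)"
    using toric_core_interlaced(1)[of j "n - 1"] assms by simp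
  have negP: "x < 0" if "poly (toric_core n j) x = 0" for x
    using toric_core_interlaced(2)[of j n] assms that by simp
  show ?thesis
  proof (cases "j = 0")
    case True
    have "strictly_interlaced (toric_core n j) (toric_g (n + 1) (j + 1))"
    proof (rule strictly_interlaced_add[OF RP negP])
      show "toric_g (n + 1) (j + 1) = toric_core n j + [:-1, 1:] * toric_core (n - 1) j"
        using toric_g_pascal[OF assms] True by (simp add: toric_core_0)
      show "0 < lead_coeff (toric_g (n + 1) (j + 1))"
        using assms by (intro degree_toric_g) simp
      show "degree (toric_g (n + 1) (j + 1)) = degree (toric_core n j) \<or>
          degree (toric_g (n + 1) (j + 1)) = Suc (degree (toric_core n j))"
        using assms True degree_toric_g(1)[of "j + 1" "n + 1"] degree_toric_core(1)[of j n] by auto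
    qed
    then show ?thesis using True by (simp add: toric_core_0 interlaces_of_strictly_interlaced)
  next
    case False
    have "strictly_interlaced (toric_core n j) (toric_core (n + 1) (j + 1))"
    proof (rule strictly_interlaced_add[OF RP negP toric_core_pascal[OF assms]])
      show "0 < lead_coeff (toric_core (n + 1) (j + 1))"
        using assms by (intro degree_toric_core) simp
      show "degree (toric_core (n + 1) (j + 1)) = degree (toric_core n j) \<or>
          degree (toric_core (n + 1) (j + 1)) = Suc (degree (toric_core n j))"
        using assms False degree_toric_core(1)[of "j + 1" "n + 1"] degree_toric_core(1)[of j n]
        by (simp, linarith)
    qed (use False in auto)
    then have "interlaces ([:0, 1:] * toric_core n j) ([:0, 1:] * toric_core (n + 1) (j + 1))"
      using assms negP toric_core_interlaced(2)[of "j + 1" "n + 1"] by (intro interlaces_mult_x) auto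
    moreover have "toric_g n j = [:0, 1:] * toric_core n j"
      using False assms by (intro toric_g_eq_x_times_core) auto
    moreover have "toric_g (n + 1) (j + 1) = [:0, 1:] * toric_core (n + 1) (j + 1)"
      using assms by (intro toric_g_eq_x_times_core) auto
    ultimately show ?thesis by simp
  qed
qed

theorem theorem1p3:
  shows "(\<forall>n j :: nat. j \<le> n div 2 \<longrightarrow> real_rooted (toric_g n j)) \<and>
         (\<forall>n j :: nat. j \<le> n div 2 \<longrightarrow> interlaces (toric_g n j) (toric_g (n + 1) j)) \<and>
         (\<forall>n j :: nat. int j \<le> (int n - 1) div 2 \<longrightarrow>
            interlaces (toric_g n j) (toric_g (n + 1) (j + 1)))"
proof (intro conjI allI impI)
  fix n j :: nat
  assume "j \<le> n div 2"
  then have "2 * j \<le> n" by simp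
  then show "interlaces (toric_g n j) (toric_g (n + 1) j)"
    by (rule toric_g_interlaces_Suc)
  then show "real_rooted (toric_g n j)"
    by (simp add: interlaces_def)
next
  fix n j :: nat
  assume "int j \<le> (int n - 1) div 2"
  then have "2 * j + 1 \<le> n" by linarith
  then show "interlaces (toric_g n j) (toric_g (n + 1) (j + 1))"
    by (rule toric_g_interlaces_Suc_Suc)
qed
end
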